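(* On $E_7:\ v^2=u(1-11u+32u^2)$ let $\Phi_7=\dfrac{128(1-4u)(-v-3u+4uv+20u^2)^7}{u^3(1-8u)(1-4v-20u+64u^2)^7}$ and $F_3=1-4v-4u$, $\widetilde F_3=1+4v-4u$, $F_4=1-2v-6u$, $\widetilde F_4=1+2v-6u$, $G_3=1+2v-10u+16u^2$, $G_4=1-4v-20u+64u^2$, $\widehat G_4=v-5u-8uv+24u^2$. Then near $(u,v)=(0,0)$ on $E_7$, with branches chosen so that each right-hand side is holomorphic at $(0,0)$ with value $1$: $${}_3F_2\!\left(-\tfrac1{14},\tfrac1{14},\tfrac9{14};\tfrac27,\tfrac67;\Phi_7\right)=\frac{(1-4u)^{1/7}(1-8u)^{4/7}F_4^{2/7}}{F_3^{1/14}\sqrt{G_4}},$$ $${}_3F_2\!\left(\tfrac1{14},\tfrac3{14},\tfrac{11}{14};\tfrac37,\tfrac87;\Phi_7\right)=\frac{(1-8u)^{1/14}\widetilde F_4^{6/7}\sqrt{G_4}}{(1-4u)^{1/7}\widetilde F_3^{3/14}G_3},$$ $${}_3F_2\!\left(\tfrac9{14},\tfrac{11}{14},\tfrac{19}{14};\tfrac{11}7,\tfrac{12}7;\Phi_7\right)=\frac{(1-8u)\widetilde F_3^{1/14}\widehat G_4^{9/2}}{u^{13/7}(v-u)^{3/14}(v+u)^{4/7}G_3^5}.$$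
   Context: ${}_3F_2(\alpha_1,\alpha_2,\alpha_3;\beta_1,\beta_2;z)=\sum_{n\ge0}\frac{(\alpha_1)_n(\alpha_2)_n(\alpha_3)_n}{(\beta_1)_n(\beta_2)_n n!}z^n$. A local parameter of $E_7$ at $(0,0)$ is $\sqrt u$. *)

theory Defs
  imports "HOL-Analysis.Analysis"
begin

definition hyp3F2 :: "complex \<Rightarrow> complex \<Rightarrow> complex \<Rightarrow> complex \<Rightarrow> complex \<Rightarrow> complex \<Rightarrow> complex" where
  "hyp3F2 a1 a2 a3 b1 b2 z =
     (\<Sum>n. (pochhammer a1 n * pochhammer a2 n * pochhammer a3 n)
            / (pochhammer b1 n * pochhammer b2 n * fact n) * z ^ n)"

text \<open>Local parametrisation of E7: v^2 = u(1-11u+32u^2) near (0,0) by the local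
  parameter t = sqrt u: u = t^2, v = t * sqrt(1-11t^2+32t^4) (principal branch, value 1 at 0).
  The other sheet v = -t * sqrt(...) is obtained from t \<mapsto> -t.\<close>
definition e7u :: "complex \<Rightarrow> complex" where
  "e7u t = t ^ 2"

definition e7v :: "complex \<Rightarrow> complex" where
  "e7v t = t * csqrt (1 - 11 * t ^ 2 + 32 * t ^ 4)"

definition Phi7 :: "complex \<Rightarrow> complex \<Rightarrow> complex" where
  "Phi7 u v = 128 * (1 - 4 * u) * (- v - 3 * u + 4 * u * v + 20 * u^2) ^ 7
              / (u ^ 3 * (1 - 8 * u) * (1 - 4 * v - 20 * u + 64 * u^2) ^ 7)"

definition F3 :: "complex \<Rightarrow> complex \<Rightarrow> complex" where "F3 u v = 1 - 4 * v - 4 * u"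
definition F3t :: "complex \<Rightarrow> complex \<Rightarrow> complex" where "F3t u v = 1 + 4 * v - 4 * u"
definition F4 :: "complex \<Rightarrow> complex \<Rightarrow> complex" where "F4 u v = 1 - 2 * v - 6 * u"
definition F4t :: "complex \<Rightarrow> complex \<Rightarrow> complex" where "F4t u v = 1 + 2 * v - 6 * u"
definition G3 :: "complex \<Rightarrow> complex \<Rightarrow> complex" where "G3 u v = 1 + 2 * v - 10 * u + 16 * u^2"
definition G4 :: "complex \<Rightarrow> complex \<Rightarrow> complex" where "G4 u v = 1 - 4 * v - 20 * u + 64 * u^2"
definition G4h :: "complex \<Rightarrow> complex \<Rightarrow> complex" where "G4h u v = v - 5 * u - 8 * u * v + 24 * u^2"

end

theory Submission
  imports Defs "HOL-Complex_Analysis.Complex_Analysis"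
begin

text \<open>
  Near the origin the pullback \<open>\<Phi>\<^sub>7\<close> is a local coordinate on the curve, so a right-hand side \<open>R\<close> is
  a power series in \<open>z = \<Phi>\<^sub>7\<close>. If \<open>R\<close> satisfies the third-order hypergeometric equation in \<open>z\<close>, its
  coefficients obey the two-term recurrence of the \<open>\<^sub>3F\<^sub>2\<close> series, and \<open>R = 1\<close> at the origin then
  forces equality. Since \<open>R ^ 14\<close> is a rational function on the curve, \<open>\<theta> R / R\<close> with
  \<open>\<theta> = z d/dz\<close> is rational too, and the differential equation becomes an identity in the
  coordinate ring \<open>\<int>[u, v] / (v\<^sup>2 - u (1 - 11 u + 32 u\<^sup>2))\<close>, which is decided by computation.
\<close>

section \<open>Germs of analytic functions\<close>

lemma eventually_compose_analytic:
  assumes "g analytic_on {0}" "g 0 = 0" "\<forall>\<^sub>F t in nhds 0. P t"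
  shows "\<forall>\<^sub>F z in nhds (0::complex). P (g z)"
proof -
  have "isCont g 0" using assms(1) by (rule analytic_at_imp_isCont)
  then have "filterlim g (nhds 0) (nhds 0)"
    using assms(2) by (metis isCont_def tendsto_at_iff_tendsto_nhds)
  then show ?thesis using assms(3) by (simp add: filterlim_iff)
qed

lemma eventually_analytic_at:
  assumes "f analytic_on {a}"
  shows "\<forall>\<^sub>F t in nhds a. f analytic_on {t}"
proof -
  obtain S where "open S" "a \<in> S" "f holomorphic_on S" using assms analytic_at by blast
  then have "\<forall>\<^sub>F t in nhds a. t \<in> S" by (intro eventually_nhds_in_open)
  then show ?thesis
    by eventually_elim (use \<open>open S\<close> \<open>f holomorphic_on S\<close> analytic_at in blast)
qed

lemma eventually_analytic_ne_0:
  assumes "f analytic_on {a}" "f a \<noteq> 0"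
  shows "\<forall>\<^sub>F t in nhds a. f t \<noteq> 0"
  using analytic_at_imp_isCont[OF assms(1)] assms(2)
  by (metis isCont_def tendsto_at_iff_tendsto_nhds tendsto_imp_eventually_ne)

lemma eventually_at_0: "\<forall>\<^sub>F t in nhds 0. P t \<Longrightarrow> \<forall>\<^sub>F t in at (0::complex). P t"
  by (simp add: eventually_at_filter eventually_mono)

lemma eventually_ne_0: "\<forall>\<^sub>F t in at (0::complex). t \<noteq> 0"
  by (simp add: eventually_at_filter)

text \<open>Continuity carries an identity across the puncture. Identities obtained from products
  with factors vanishing at the origin are at first available only for
  \<open>t \<noteq> 0\<close>.\<close>

lemma eventually_nhds_analytic_eq:
  assumes "f analytic_on {a}" "g analytic_on {a}" "\<forall>\<^sub>F t in at a. f t = g t"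
  shows "\<forall>\<^sub>F t in nhds a. f t = g t"
proof -
  have "(f \<longlongrightarrow> f a) (at a)" "(g \<longlongrightarrow> g a) (at a)"
    using assms(1,2) analytic_at_imp_isCont isCont_def by blast+
  with assms(3) have "f a = g a"
    using tendsto_unique[of "at a" f "f a" "g a"] tendsto_cong[OF assms(3)] by auto
  with assms(3) show ?thesis
    by (auto simp: eventually_at_filter elim: eventually_mono)
qed

text \<open>Allows an identity known only on a punctured neighbourhood to be differentiated: around
  each nearby point other than \<open>a\<close> it holds on a full neighbourhood.\<close>

lemma eventually_at_eventually_nhds:
  fixes a :: "'a :: t1_space"
  assumes "eventually P (at a)"
  shows "\<forall>\<^sub>F t in at a. eventually P (nhds t)"
proof -
  obtain S where S: "open S" "a \<in> S" "\<And>x. x \<in> S \<Longrightarrow> x \<noteq> a \<Longrightarrow> P x"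
    using assms unfolding eventually_at_topological by auto
  have "eventually P (nhds t)" if "t \<in> S" "t \<noteq> a" for t
    unfolding eventually_nhds using S that by (intro exI[of _ "S - {a}"]) auto
  with S show ?thesis
    unfolding eventually_at_topological by blast
qed

lemma analytic_at_0_ballI:
  fixes R :: "complex \<Rightarrow> complex"
  assumes "R analytic_on {0}" "R 0 = 1" "\<forall>\<^sub>F t in at 0. P t (R t)"
  shows "\<exists>r>0. \<exists>R. R holomorphic_on ball 0 r \<and> R 0 = 1 \<and> (\<forall>t\<in>ball 0 r. t \<noteq> 0 \<longrightarrow> P t (R t))"
proof -
  obtain r where r: "r > 0" "R holomorphic_on ball 0 r"
    using assms(1) analytic_at_ball by blast
  obtain s where s: "s > 0" "\<And>t. t \<noteq> 0 \<Longrightarrow> dist t 0 < s \<Longrightarrow> P t (R t)"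
    using assms(3) unfolding eventually_at by auto
  have "R holomorphic_on ball 0 (min r s)"
    using r by (rule_tac holomorphic_on_subset[of R "ball 0 r"]) auto
  with r s assms(2) show ?thesis
    by (intro exI[of _ "min r s"] conjI exI[of _ R]) (auto simp: dist_commute)
qed

lemma analytic_local_inverse:
  assumes "f analytic_on {0}" "f 0 = 0" "deriv f 0 \<noteq> 0"
  obtains g where "g analytic_on {0}" "g 0 = 0"
    "\<forall>\<^sub>F t in nhds 0. g (f t) = t" "\<forall>\<^sub>F z in nhds 0. f (g z) = z"
    "\<forall>\<^sub>F z in nhds 0. deriv f (g z) * deriv g z = 1"
proof -
  obtain S where S: "open S" "0 \<in> S" "f holomorphic_on S"
    using assms(1) analytic_at by blast
  obtain r where r: "r > 0" "ball 0 r \<subseteq> S" "inj_on f (ball 0 r)"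
    using has_complex_derivative_locally_injective[OF S(3,2,1) assms(3)] by blast
  have hol: "f holomorphic_on ball 0 r" using S r by (auto intro: holomorphic_on_subset)
  obtain g where g: "g holomorphic_on f ` ball 0 r"
      "\<And>z. z \<in> ball 0 r \<Longrightarrow> deriv f z * deriv g (f z) = 1"
      "\<And>z. z \<in> ball 0 r \<Longrightarrow> g (f z) = z"
    using holomorphic_has_inverse[OF hol open_ball r(3)] by blast
  have op: "open (f ` ball 0 r)" by (rule open_mapping_thm3[OF hol open_ball r(3)])
  have 0: "0 \<in> f ` ball 0 r" using r(1) assms(2) by (force simp: image_iff)
  have ev: "\<forall>\<^sub>F z in nhds 0. z \<in> f ` ball 0 r" by (rule eventually_nhds_in_open[OF op 0])
  show ?thesis
  proof
    show "g analytic_on {0}" using g(1) op 0 analytic_at by blast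
    show "g 0 = 0" using g(3)[of 0] r(1) assms(2) by simp
    show "\<forall>\<^sub>F t in nhds 0. g (f t) = t"
      using eventually_nhds_in_open[of "ball 0 r" 0] r(1) g(3) by (auto elim: eventually_mono)
    show "\<forall>\<^sub>F z in nhds 0. f (g z) = z" using ev by eventually_elim (use g in auto)
    show "\<forall>\<^sub>F z in nhds 0. deriv f (g z) * deriv g z = 1" using ev by eventually_elim (use g in auto)
  qed
qed

section \<open>Pulling back the hypergeometric equation\<close>

lemma pochhammer_ne_0:
  fixes b :: "'a :: field_char_0"
  assumes "\<And>n::nat. b + of_nat n \<noteq> 0"
  shows "pochhammer b n \<noteq> 0"
  using assms by (auto simp: pochhammer_prod)

text \<open>The conditions on \<open>b1\<close> and \<open>b2\<close> make the factor of
  \<open>fps_nth H (Suc n)\<close> invertible, so the recurrence and the constant term determine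
  \<open>H\<close>. Both sides are then the same \<open>suminf\<close>, whether or not it converges
  at \<open>z\<close>.\<close>

lemma hyp3F2_fps_unique:
  fixes H :: "complex fps"
  assumes b1: "\<And>n::nat. b1 + of_nat n \<noteq> 0" and b2: "\<And>n::nat. b2 + of_nat n \<noteq> 0"
    and rec: "\<And>n. of_nat (Suc n) * (of_nat n + b1) * (of_nat n + b2) * fps_nth H (Suc n)
                  = (of_nat n + a1) * (of_nat n + a2) * (of_nat n + a3) * fps_nth H n"
    and H0: "fps_nth H 0 = 1"
  shows "eval_fps H z = hyp3F2 a1 a2 a3 b1 b2 z"
proof -
  have "fps_nth H n = (pochhammer a1 n * pochhammer a2 n * pochhammer a3 n)
            / (pochhammer b1 n * pochhammer b2 n * fact n)" for n
  proof (induction n)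
    case (Suc n)
    have nz: "pochhammer b1 n \<noteq> 0" "pochhammer b2 n \<noteq> 0"
        "of_nat n + b1 \<noteq> 0" "of_nat n + b2 \<noteq> 0"
      using b1 b2 pochhammer_ne_0[of b1] pochhammer_ne_0[of b2] by (auto simp: add.commute)
    have "fps_nth H (Suc n) = (of_nat n + a1) * (of_nat n + a2) * (of_nat n + a3) * fps_nth H n
             / (of_nat (Suc n) * (of_nat n + b1) * (of_nat n + b2))"
      using rec[of n] nz by (simp add: divide_simps mult_ac del: of_nat_Suc)
    then show ?case
      using nz by (simp add: Suc.IH pochhammer_Suc add.commute mult_ac)
  qed (simp add: H0)
  then show ?thesis
    by (simp add: eval_fps_def hyp3F2_def)
qed

text \<open>With \<theta> = z d/dz and \<open>h1\<close>, \<open>h2\<close>, \<open>h3\<close> its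
  iterates on \<open>h0\<close>, \<open>ode\<close> is the expanded form of \<theta>(\<theta> + b1 -
  1)(\<theta> + b2 - 1) h = z (\<theta> + a1)(\<theta> + a2)(\<theta> + a3) h. On power series
  \<theta> multiplies the n-th coefficient by n, so comparing coefficients gives a two-term
  recurrence.\<close>

lemma hyp3F2_ode_unique:
  fixes h0 h1 h2 h3 :: "complex \<Rightarrow> complex"
  assumes b: "\<And>n::nat. b1 + of_nat n \<noteq> 0" "\<And>n::nat. b2 + of_nat n \<noteq> 0"
    and an: "h0 analytic_on {0}"
    and init: "h0 0 = 1"
    and euler: "\<forall>\<^sub>F z in nhds 0. z * deriv h0 z = h1 z"
      "\<forall>\<^sub>F z in nhds 0. z * deriv h1 z = h2 z" "\<forall>\<^sub>F z in nhds 0. z * deriv h2 z = h3 z"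
    and ode: "\<forall>\<^sub>F z in nhds 0. h3 z + (b1 + b2 - 2) * h2 z + (b1 - 1) * (b2 - 1) * h1 z
       = z * (h3 z + (a1 + a2 + a3) * h2 z + (a1 * a2 + a1 * a3 + a2 * a3) * h1 z + a1 * a2 * a3 * h0 z)"
  shows "\<forall>\<^sub>F z in nhds 0. hyp3F2 a1 a2 a3 b1 b2 z = h0 z"
proof -
  define H where "H = fps_expansion h0 0"
  have exp0: "h0 has_fps_expansion H"
    unfolding H_def by (rule analytic_at_imp_has_fps_expansion_0) fact
  have cong: "g has_fps_expansion F" if "f has_fps_expansion F" "\<forall>\<^sub>F z in nhds 0. f z = g z"
    for f g :: "complex \<Rightarrow> complex" and F
    using that unfolding has_fps_expansion_def by (auto elim: eventually_elim2)
  define \<theta> where "\<theta> = (\<lambda>F :: complex fps. fps_X * fps_deriv F)"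
  have step: "g has_fps_expansion \<theta> F" if "f has_fps_expansion F" "\<forall>\<^sub>F z in nhds 0. z * deriv f z = g z" for f g F
    unfolding \<theta>_def by (rule cong[OF _ that(2)]) (intro fps_expansion_intros that(1))
  have exp1: "h1 has_fps_expansion \<theta> H" by (rule step[OF exp0 euler(1)])
  have exp2: "h2 has_fps_expansion \<theta> (\<theta> H)" by (rule step[OF exp1 euler(2)])
  have exp3: "h3 has_fps_expansion \<theta> (\<theta> (\<theta> H))" by (rule step[OF exp2 euler(3)])
  have nth: "fps_nth (\<theta> F) n = of_nat n * fps_nth F n" for F n
    by (cases n) (simp_all add: \<theta>_def)
  define L where "L = \<theta> (\<theta> (\<theta> H)) + fps_const (b1 + b2 - 2) * \<theta> (\<theta> H) + fps_const ((b1 - 1) * (b2 - 1)) * \<theta> H"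
  define M where "M = \<theta> (\<theta> (\<theta> H)) + fps_const (a1 + a2 + a3) * \<theta> (\<theta> H)
      + fps_const (a1 * a2 + a1 * a3 + a2 * a3) * \<theta> H + fps_const (a1 * a2 * a3) * H"
  have "(\<lambda>z. h3 z + (b1 + b2 - 2) * h2 z + (b1 - 1) * (b2 - 1) * h1 z) has_fps_expansion L"
    unfolding L_def by (intro fps_expansion_intros exp1 exp2 exp3)
  from cong[OF this ode] have exp: "(\<lambda>z. z * (h3 z + (a1 + a2 + a3) * h2 z + (a1 * a2 + a1 * a3 + a2 * a3) * h1 z + a1 * a2 * a3 * h0 z))
      has_fps_expansion L" .
  have "L = fps_X * M"
    by (rule fps_expansion_unique_complex[OF exp])
      (unfold M_def, intro fps_expansion_intros exp0 exp1 exp2 exp3)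
  then have LM: "fps_nth L (Suc n) = fps_nth M n" for n
    by simp
  have "eval_fps H z = hyp3F2 a1 a2 a3 b1 b2 z" for z
  proof (rule hyp3F2_fps_unique[OF b])
    show "fps_nth H 0 = 1"
      using has_fps_expansion_imp_0_eq_fps_nth_0[OF exp0] init by simp
    show "of_nat (Suc n) * (of_nat n + b1) * (of_nat n + b2) * fps_nth H (Suc n)
                  = (of_nat n + a1) * (of_nat n + a2) * (of_nat n + a3) * fps_nth H n" for n
      proof -
      define k :: complex where "k = of_nat n"
      \<comment> \<open>At index n + 1 the factor \<theta> + b1 - 1 acts as n + b1, and likewise for
        \<open>b2\<close>; this shift produces the shape of the recurrence.\<close>
      have "(1 + k) ^ 3 * fps_nth H (Suc n) + (b1 + b2 - 2) * ((1 + k) ^ 2 * fps_nth H (Suc n))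
              + (b1 - 1) * (b2 - 1) * ((1 + k) * fps_nth H (Suc n))
          = k ^ 3 * fps_nth H n + (a1 + a2 + a3) * (k ^ 2 * fps_nth H n)
              + (a1 * a2 + a1 * a3 + a2 * a3) * (k * fps_nth H n) + a1 * a2 * a3 * fps_nth H n"
        using LM[of n] by (simp add: L_def M_def nth k_def power2_eq_square power3_eq_cube mult.assoc)
      moreover have "of_nat (Suc n) = 1 + k"
        by (simp add: k_def)
      ultimately show ?thesis
        unfolding k_def[symmetric] by algebra
    qed
  qed
  then show ?thesis
    using exp0 by (simp add: has_fps_expansion_def)
qed

text \<open>The hypotheses \<open>euler\<close> say that each function is \<theta> of the previous
  one in the coordinate z = \<Phi>, multiplied through by the derivative of \<Phi>. Composition with
  the local inverse of \<Phi> reduces everything to functions of z.\<close>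

lemma hyp3F2_pullback:
  fixes \<Phi> R0 R1 R2 R3 :: "complex \<Rightarrow> complex"
  assumes b: "\<And>n::nat. b1 + of_nat n \<noteq> 0" "\<And>n::nat. b2 + of_nat n \<noteq> 0"
    and \<Phi>: "\<Phi> analytic_on {0}" "\<Phi> 0 = 0" "deriv \<Phi> 0 \<noteq> 0"
    and an: "R0 analytic_on {0}" "R1 analytic_on {0}" "R2 analytic_on {0}"
    and init: "R0 0 = 1"
    and euler: "\<forall>\<^sub>F t in nhds 0. \<Phi> t * deriv R0 t = deriv \<Phi> t * R1 t"
      "\<forall>\<^sub>F t in nhds 0. \<Phi> t * deriv R1 t = deriv \<Phi> t * R2 t"
      "\<forall>\<^sub>F t in nhds 0. \<Phi> t * deriv R2 t = deriv \<Phi> t * R3 t"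
    and ode: "\<forall>\<^sub>F t in nhds 0. R3 t + (b1 + b2 - 2) * R2 t + (b1 - 1) * (b2 - 1) * R1 t
       = \<Phi> t * (R3 t + (a1 + a2 + a3) * R2 t + (a1 * a2 + a1 * a3 + a2 * a3) * R1 t + a1 * a2 * a3 * R0 t)"
  shows "\<forall>\<^sub>F t in nhds 0. hyp3F2 a1 a2 a3 b1 b2 (\<Phi> t) = R0 t"
proof -
  obtain g where g: "g analytic_on {0}" "g 0 = 0"
    "\<forall>\<^sub>F t in nhds 0. g (\<Phi> t) = t" "\<forall>\<^sub>F z in nhds 0. \<Phi> (g z) = z"
    "\<forall>\<^sub>F z in nhds 0. deriv \<Phi> (g z) * deriv g z = 1"
    using analytic_local_inverse[OF \<Phi>] by blast
  have comp: "(\<lambda>z. f (g z)) analytic_on {0}" if "f analytic_on {0}" for f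
    using analytic_on_compose[OF g(1), of f] that g(2) by (simp add: o_def)
  have euler': "\<forall>\<^sub>F z in nhds 0. z * deriv (\<lambda>z. f (g z)) z = k (g z)"
    if f: "f analytic_on {0}" and k: "\<forall>\<^sub>F t in nhds 0. \<Phi> t * deriv f t = deriv \<Phi> t * k t" for f k
    using g(4,5) eventually_compose_analytic[OF g(1,2) k] eventually_analytic_at[OF g(1)]
      eventually_compose_analytic[OF g(1,2) eventually_analytic_at[OF f]]
  proof eventually_elim
    case (elim z)
    have "deriv (\<lambda>z. f (g z)) z = deriv f (g z) * deriv g z"
      using elim(4,5) by (intro DERIV_imp_deriv DERIV_chain2[where f=f] analytic_derivI)
    then have "z * deriv (\<lambda>z. f (g z)) z = (\<Phi> (g z) * deriv f (g z)) * deriv g z"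
      using elim(1) by simp
    also have "\<dots> = k (g z) * (deriv \<Phi> (g z) * deriv g z)"
      unfolding elim(3) by simp
    finally show ?case using elim(2) by simp
  qed
  have "\<forall>\<^sub>F z in nhds 0. hyp3F2 a1 a2 a3 b1 b2 z = R0 (g z)"
  proof (rule hyp3F2_ode_unique[where ?h0.0="\<lambda>z. R0 (g z)" and ?h1.0="\<lambda>z. R1 (g z)"
        and ?h2.0="\<lambda>z. R2 (g z)" and ?h3.0="\<lambda>z. R3 (g z)"])
    show "\<forall>\<^sub>F z in nhds 0. R3 (g z) + (b1 + b2 - 2) * R2 (g z) + (b1 - 1) * (b2 - 1) * R1 (g z)
       = z * (R3 (g z) + (a1 + a2 + a3) * R2 (g z) + (a1 * a2 + a1 * a3 + a2 * a3) * R1 (g z) + a1 * a2 * a3 * R0 (g z))"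
      using g(4) eventually_compose_analytic[OF g(1,2) ode] by eventually_elim simp
  qed (simp_all add: b comp an init g(2) euler' euler)
  from eventually_compose_analytic[OF \<Phi>(1,2) this] g(3) show ?thesis
    by eventually_elim simp
qed

section \<open>The coordinate ring of the curve\<close>

text \<open>Integer coefficient lists reduce polynomial identities to ground arithmetic, which
  \<open>code_simp\<close> can evaluate.\<close>

primrec lev :: "int list \<Rightarrow> complex \<Rightarrow> complex" where
  "lev [] x = 0"
| "lev (a # p) x = of_int a + x * lev p x"

fun ladd :: "int list \<Rightarrow> int list \<Rightarrow> int list" where
  "ladd [] q = q"
| "ladd (a # p) [] = a # p"
| "ladd (a # p) (b # q) = (a + b) # ladd p q"

primrec lmul :: "int list \<Rightarrow> int list \<Rightarrow> int list" where
  "lmul [] q = []"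
| "lmul (a # p) q = ladd (map ((*) a) q) (0 # lmul p q)"

text \<open>Product rule for the Horner form: the derivative of a + x p is p + x p'.\<close>

primrec lder :: "int list \<Rightarrow> int list" where
  "lder [] = []"
| "lder (a # p) = ladd p (0 # lder p)"

lemma lev_ladd: "lev (ladd p q) x = lev p x + lev q x"
  by (induction p q rule: ladd.induct) (simp_all add: algebra_simps)

lemma lev_smult: "lev (map ((*) a) p) x = of_int a * lev p x"
  by (induction p) (simp_all add: algebra_simps)

lemma lev_lmul: "lev (lmul p q) x = lev p x * lev q x"
  by (induction p) (simp_all add: lev_ladd lev_smult algebra_simps)

lemma DERIV_lev: "(lev p has_field_derivative lev (lder p) x) (at x)"
proof (induction p)
  case (Cons a p)
  show ?case
    by (auto intro!: derivative_eq_intros Cons simp: lev_ladd)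
qed simp

lemma lev_null: "list_all ((=) 0) p \<Longrightarrow> lev p x = 0"
  by (induction p) auto

text \<open>\<open>E7 a b\<close> is the function \<open>a(u) + b(u) v\<close> on the curve, with coefficient lists in
  ascending order and arithmetic modulo \<open>v\<^sup>2 = u (1 - 11 u + 32 u\<^sup>2)\<close>. Trailing zeros are not
  removed, so equality in the coordinate ring is \<open>null7 (x - y)\<close>.\<close>
datatype e7 = E7 "int list" "int list"

instantiation e7 :: "{plus, minus, times, one}"
begin

fun plus_e7 :: "e7 \<Rightarrow> e7 \<Rightarrow> e7" where
  "E7 a b + E7 c d = E7 (ladd a c) (ladd b d)"

fun minus_e7 :: "e7 \<Rightarrow> e7 \<Rightarrow> e7" where
  "E7 a b - E7 c d = E7 (ladd a (map ((*) (-1)) c)) (ladd b (map ((*) (-1)) d))"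

definition one_e7 :: e7 where
  "1 = E7 [1] []"

fun times_e7 :: "e7 \<Rightarrow> e7 \<Rightarrow> e7" where
  "E7 a b * E7 c d =
     E7 (ladd (lmul a c) (lmul [0, 1, -11, 32] (lmul b d))) (ladd (lmul a d) (lmul b c))"

instance ..

end

instance e7 :: power ..

definition const7 :: "int \<Rightarrow> e7" where
  "const7 k = E7 [k] []"

text \<open>The derivation with \<open>D u = 2 v\<close>, which forces \<open>D v = 1 - 22 u + 96 u\<^sup>2\<close>;
  in terms of the local parameter, \<open>d/dt\<close> is \<open>D\<close> divided by \<open>v / t\<close>.\<close>
fun D7 :: "e7 \<Rightarrow> e7" where
  "D7 (E7 a b) =
     E7 (ladd (lmul [0, 2, -22, 64] (lder b)) (lmul [1, -22, 96] b)) (map ((*) 2) (lder a))"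

fun null7 :: "e7 \<Rightarrow> bool" where
  "null7 (E7 a b) \<longleftrightarrow> list_all ((=) 0) a \<and> list_all ((=) 0) b"

primrec ev7 :: "e7 \<Rightarrow> complex \<Rightarrow> complex" where
  "ev7 (E7 a b) t = lev a (e7u t) + lev b (e7u t) * e7v t"

text \<open>The unit \<open>v / t\<close>.\<close>
definition e7q :: "complex \<Rightarrow> complex" where
  "e7q t = csqrt (1 - 11 * t ^ 2 + 32 * t ^ 4)"

lemma e7v_eq: "e7v t = t * e7q t"
  by (simp add: e7v_def e7q_def)

lemma e7q_squared: "e7q t ^ 2 = 1 - 11 * t ^ 2 + 32 * t ^ 4"
  by (simp add: e7q_def)

lemma e7v_squared: "e7v t ^ 2 = e7u t * (1 - 11 * e7u t + 32 * e7u t ^ 2)"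
  by (simp add: e7v_eq power_mult_distrib e7q_squared e7u_def)

lemma ev7_add: "ev7 (x + y) t = ev7 x t + ev7 y t"
  by (cases x; cases y) (simp add: lev_ladd algebra_simps)

lemma ev7_diff: "ev7 (x - y) t = ev7 x t - ev7 y t"
  by (cases x; cases y) (simp add: lev_ladd lev_smult algebra_simps)

lemma ev7_one: "ev7 1 t = 1"
  by (simp add: one_e7_def)

lemma ev7_const: "ev7 (const7 k) t = of_int k"
  by (simp add: const7_def)

lemma ev7_mult: "ev7 (x * y) t = ev7 x t * ev7 y t"
proof (cases x; cases y)
  fix a b c d assume [simp]: "x = E7 a b" "y = E7 c d"
  \<comment> \<open>The equation of the curve enters the multiplication rule here: the list used in
    \<open>times_e7\<close> evaluates to the square of v.\<close>
  have W: "lev [0, 1, -11, 32] (e7u t) = e7v t ^ 2"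
    unfolding e7v_squared by (simp add: power2_eq_square algebra_simps)
  show ?thesis
    by (simp only: \<open>x = _\<close> \<open>y = _\<close> times_e7.simps ev7.simps lev_ladd lev_lmul W)
       (simp add: power2_eq_square algebra_simps)
qed

lemma ev7_power: "ev7 (x ^ n) t = ev7 x t ^ n"
  by (induction n) (simp_all add: ev7_one ev7_mult)

lemmas ev7_simps = ev7_add ev7_diff ev7_one ev7_const ev7_mult ev7_power

lemma null7_eq: "null7 (x - y) \<Longrightarrow> ev7 x t = ev7 y t"
  using ev7_diff[of x y t] by (cases "x - y") (auto simp: lev_null)

section \<open>Analyticity and differentiation along the local parametrisation\<close>

lemma e7q_0 [simp]: "e7q 0 = 1" and e7u_0 [simp]: "e7u 0 = 0" and e7v_0 [simp]: "e7v 0 = 0"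
  by (simp_all add: e7q_def e7u_def e7v_def)

lemma e7q_analytic [analytic_intros]: "e7q analytic_on {0}"
  unfolding e7q_def by (intro analytic_intros) auto

lemma e7u_analytic [analytic_intros]: "e7u analytic_on {0}"
  unfolding e7u_def by (intro analytic_intros)

lemma e7v_analytic [analytic_intros]: "e7v analytic_on {0}"
  unfolding e7v_eq[abs_def] by (intro analytic_intros)

lemma lev_e7u_analytic [analytic_intros]: "(\<lambda>t. lev p (e7u t)) analytic_on {0}"
  by (induction p) (auto intro!: analytic_intros)

lemma ev7_analytic [analytic_intros]: "ev7 x analytic_on {0}"
proof (cases x)
  case (E7 a b)
  then have "ev7 x = (\<lambda>t. lev a (e7u t) + lev b (e7u t) * e7v t)"
    by (simp add: fun_eq_iff)
  then show ?thesis
    by (simp add: analytic_intros)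
qed

lemma e7q_derivative:
  assumes "1 - 11 * t ^ 2 + 32 * t ^ 4 \<notin> \<real>\<^sub>\<le>\<^sub>0"
  shows "(e7q has_field_derivative (64 * t ^ 3 - 11 * t) / e7q t) (at t)"
proof -
  have "((128 * t ^ 3 - 22 * t) / (2 * c)) = (64 * t ^ 3 - 11 * t) / c" for c
    by (cases "c = 0") (simp_all add: field_simps)
  moreover have "((\<lambda>t. csqrt (1 - 11 * t ^ 2 + 32 * t ^ 4)) has_field_derivative
      (128 * t ^ 3 - 22 * t) / (2 * csqrt (1 - 11 * t ^ 2 + 32 * t ^ 4))) (at t)"
    using assms by (auto intro!: derivative_eq_intros)
  ultimately show ?thesis
    by (simp add: e7q_def[abs_def])
qed

text \<open>Since du/dt = 2 t = 2 v / q with q = v / t, the derivation \<open>D7\<close> is q d/dt.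
  One neighbourhood serves all \<open>x\<close>: it depends only on q being nonzero and its radicand
  avoiding the branch cut.\<close>

lemma ev7_derivative: "\<forall>\<^sub>F t in nhds 0. \<forall>x. (ev7 x has_field_derivative ev7 (D7 x) t / e7q t) (at t)"
proof -
  have "\<forall>\<^sub>F t in nhds (0::complex). 1 - 11 * t ^ 2 + 32 * t ^ 4 \<in> - \<real>\<^sub>\<le>\<^sub>0"
  proof (rule topological_tendstoD)
    show "((\<lambda>t. 1 - 11 * t ^ 2 + 32 * t ^ 4) \<longlongrightarrow> 1) (nhds (0::complex))"
      by (auto intro!: tendsto_eq_intros filterlim_ident)
  qed auto
  moreover have "\<forall>\<^sub>F t in nhds 0. e7q t \<noteq> 0"
    by (rule eventually_analytic_ne_0) (auto intro: analytic_intros)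
  ultimately show ?thesis
  proof eventually_elim
    case (elim t)
    have q: "(e7q has_field_derivative (64 * t ^ 3 - 11 * t) / e7q t) (at t)"
      using elim(1) by (intro e7q_derivative) auto
    have u: "(e7u has_field_derivative 2 * e7v t / e7q t) (at t)"
      unfolding e7u_def[abs_def] using elim(2) by (auto intro!: derivative_eq_intros simp: e7v_eq)
    \<comment> \<open>From v = t q, the derivative is (q^2 + 64 t^4 - 11 t^2) / q; substituting the
      radicand for q^2 gives the stated numerator.\<close>
    have v: "(e7v has_field_derivative (1 - 22 * e7u t + 96 * e7u t ^ 2) / e7q t) (at t)"
      unfolding e7v_eq[abs_def]
      by (rule derivative_eq_intros q refl)+
         (use elim(2) e7q_squared[of t] in
           \<open>simp add: e7u_def divide_simps power2_eq_square; simp add: algebra_simps power_numeral_reduce\<close>)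
    have l: "((\<lambda>t. lev p (e7u t)) has_field_derivative lev (lder p) (e7u t) * (2 * e7v t / e7q t)) (at t)" for p
      by (rule DERIV_chain2[OF DERIV_lev u])
    have "(ev7 (E7 a b) has_field_derivative ev7 (D7 (E7 a b)) t / e7q t) (at t)" for a b
    proof -
      have D: "ev7 (D7 (E7 a b)) t = 2 * e7v t ^ 2 * lev (lder b) (e7u t)
              + (1 - 22 * e7u t + 96 * e7u t ^ 2) * lev b (e7u t) + 2 * lev (lder a) (e7u t) * e7v t"
        unfolding e7v_squared
        by (simp add: lev_ladd lev_lmul lev_smult power2_eq_square algebra_simps)
      have der: "((\<lambda>t. lev a (e7u t) + lev b (e7u t) * e7v t) has_field_derivative
          lev (lder a) (e7u t) * (2 * e7v t / e7q t) + (lev (lder b) (e7u t) * (2 * e7v t / e7q t) * e7v t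
            + (1 - 22 * e7u t + 96 * e7u t ^ 2) / e7q t * lev b (e7u t))) (at t)"
        by (intro DERIV_add DERIV_mult l v)
      have "ev7 (E7 a b) = (\<lambda>t. lev a (e7u t) + lev b (e7u t) * e7v t)"
        by (simp add: fun_eq_iff)
      with DERIV_cong[OF der] show ?thesis
        unfolding D using elim(2) by (simp add: field_simps power2_eq_square)
    qed
    then show ?case
      by (metis e7.exhaust)
  qed
qed

section \<open>The pullback map\<close>

text \<open>After cancelling the common factor \<open>u\<^sup>3 (1 + 4 v - 4 u)\<^sup>2\<close> of numerator and denominator,
  \<open>\<Phi>\<^sub>7 = 128 X / Y\<close>. The Euler derivation \<open>\<theta> = \<Phi> d/d\<Phi>\<close> is \<open>(K / P) D\<close>, where \<open>P\<close> vanishes on the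
  points above \<open>\<Phi>\<^sub>7 = 1\<close>, all of ramification index 2, and at the auxiliary point
  \<open>(1/8, 1/8)\<close>, needed to make its divisor principal.\<close>
definition X7 :: e7 where
  "X7 = E7
    [0, -13, 556, -10416, 114880, -873472, 5268480, -27295744, 114163712, -330956800,
     546832384, -320864256, -155189248]
    [-1, -12, 1488, -33088, 375808, -2575360, 11034624, -27754496, 29097984, 25165824,
     -67108864, -4194304]"

definition Y7 :: e7 where
  "Y7 = E7
    [1, 468, -12320, -59136, 6420480, -117653504, 1163395072, -7153385472, 27866955776,
     -64827162624, 71403831296, 8589934592, -68719476736]
    [-36, -2080, 119040, -2336768, 26132480, -202113024, 1199570944, -5435817984,
     17045651456, -31675383808, 25769803776]"

definition K7 :: e7 where
  "K7 = E7 [0, 5, -152, 1712, -8832, 20480, -16384] [-1, 32, -336, 1408, -2048]"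

definition P7 :: e7 where
  "P7 = E7 [-1, 84, -864, -3456, 89088, -450560, 737280] [-44, 672, -2944, 1024, 16384, -16384]"

definition pull7 :: "complex \<Rightarrow> complex" where
  "pull7 t = 128 * ev7 X7 t / ev7 Y7 t"

lemma X7_identity:
  "null7 (X7 * E7 [0, 1] [] ^ 3 * E7 [1, -4] [4] ^ 2 - E7 [1, -4] [] * E7 [0, -3, 20] [-1, 4] ^ 7)"
  by code_simp

lemma Y7_identity:
  "null7 (Y7 * E7 [1, -4] [4] ^ 2 - E7 [1, -8] [] * E7 [1, -20, 64] [-4] ^ 7)"
  by code_simp

text \<open>Dividing by K X Y, this says that the logarithmic derivative of X / Y under
  \<open>D7\<close> is P / K, whence \<theta> = (K / P) D.\<close>

lemma K7_P7_identity:
  "null7 (K7 * (D7 X7 * Y7 - X7 * D7 Y7) - P7 * X7 * Y7)"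
  by code_simp

text \<open>The double points above \<Phi> = 1 make 1 - \<Phi> a square up to simple factors. This
  later trades Y - 128 X for the square of P.\<close>

lemma P7_squared_identity:
  "null7 ((Y7 - const7 128 * X7) * E7 [1, -4] [-4] - E7 [1, -8] [] * P7 ^ 2)"
  by code_simp

lemma X7_Y7_P7_0: "ev7 X7 0 = 0" "ev7 Y7 0 = 1" "ev7 P7 0 = -1" "ev7 (D7 X7) 0 = -1"
  by (simp_all add: X7_def Y7_def P7_def)

lemma ev7_ne_0: "ev7 x 0 \<noteq> 0 \<Longrightarrow> \<forall>\<^sub>F t in nhds 0. ev7 x t \<noteq> 0"
  by (rule eventually_analytic_ne_0[OF ev7_analytic])

lemma e7q_ne_0: "\<forall>\<^sub>F t in nhds 0. e7q t \<noteq> 0"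
  by (rule eventually_analytic_ne_0) (auto intro: analytic_intros)

text \<open>The factor u^3 cancels because \<open>t \<noteq> 0\<close>, and the other common factor
  equals 1 at the origin, hence is nonzero nearby.\<close>

lemma Phi7_eq_pull7: "\<forall>\<^sub>F t in at 0. Phi7 (e7u t) (e7v t) = pull7 t"
proof -
  have "\<forall>\<^sub>F t in nhds 0. ev7 (E7 [1, -4] [4]) t \<noteq> 0"
    by (rule ev7_ne_0) simp
  from eventually_at_0[OF this] eventually_ne_0 show ?thesis
  proof eventually_elim
    case (elim t)
    define F where "F = ev7 (E7 [1, -4] [4]) t"
    have X: "ev7 X7 t * e7u t ^ 3 * F ^ 2
        = (1 - 4 * e7u t) * (- e7v t - 3 * e7u t + 4 * e7u t * e7v t + 20 * e7u t ^ 2) ^ 7"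
      using null7_eq[OF X7_identity, of t]
      by (simp add: ev7_simps F_def power2_eq_square algebra_simps)
    have Y: "ev7 Y7 t * F ^ 2
        = (1 - 8 * e7u t) * (1 - 4 * e7v t - 20 * e7u t + 64 * e7u t ^ 2) ^ 7"
      using null7_eq[OF Y7_identity, of t]
      by (simp add: ev7_simps F_def power2_eq_square algebra_simps)
    have u: "e7u t \<noteq> 0" using elim(2) by (simp add: e7u_def)
    have "Phi7 (e7u t) (e7v t) = 128 * (ev7 X7 t * e7u t ^ 3 * F ^ 2) / (e7u t ^ 3 * (ev7 Y7 t * F ^ 2))"
      unfolding X Y Phi7_def by (simp only: mult.assoc)
    also have "\<dots> = pull7 t"
      using u elim(1) by (simp add: pull7_def F_def)
    finally show ?case .
  qed
qed

lemma pull7_derivative: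
  "\<forall>\<^sub>F t in nhds 0. deriv pull7 t
     = 128 * (ev7 (D7 X7) t * ev7 Y7 t - ev7 X7 t * ev7 (D7 Y7) t) / (e7q t * ev7 Y7 t ^ 2)"
proof -
  have "\<forall>\<^sub>F t in nhds 0. ev7 Y7 t \<noteq> 0"
    by (rule ev7_ne_0) (simp add: X7_Y7_P7_0)
  then show ?thesis
    using ev7_derivative e7q_ne_0
  proof eventually_elim
    case (elim t)
    have "((\<lambda>t. 128 * ev7 X7 t / ev7 Y7 t) has_field_derivative
       ((128 * (ev7 (D7 X7) t / e7q t)) * ev7 Y7 t - (128 * ev7 X7 t) * (ev7 (D7 Y7) t / e7q t))
         / (ev7 Y7 t * ev7 Y7 t)) (at t)"
      using elim by (intro DERIV_divide DERIV_cmult) auto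
    then have "deriv pull7 t = ((128 * (ev7 (D7 X7) t / e7q t)) * ev7 Y7 t
        - (128 * ev7 X7 t) * (ev7 (D7 Y7) t / e7q t)) / (ev7 Y7 t * ev7 Y7 t)"
      unfolding pull7_def[abs_def] by (rule DERIV_imp_deriv)
    then show ?case
      using elim by (simp add: field_simps power2_eq_square)
  qed
qed

lemma pull7_analytic: "pull7 analytic_on {0}"
  unfolding pull7_def[abs_def] by (intro analytic_intros) (simp add: X7_Y7_P7_0)

lemma pull7_0: "pull7 0 = 0"
  by (simp add: pull7_def X7_Y7_P7_0)

lemma deriv_pull7_0: "deriv pull7 0 \<noteq> 0"
  \<comment> \<open>The derivative formula holds at t = 0 itself, where it gives -128.\<close>
  using eventually_nhds_x_imp_x[OF pull7_derivative] by (simp add: X7_Y7_P7_0)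

text \<open>This is P \<Phi> = K D\<Phi> with D = q d/dt, left undivided because K vanishes at the
  origin.\<close>

lemma pull7_euler:
  "\<forall>\<^sub>F t in nhds 0. ev7 P7 t * pull7 t = ev7 K7 t * e7q t * deriv pull7 t"
proof -
  have "\<forall>\<^sub>F t in nhds 0. ev7 Y7 t \<noteq> 0"
    by (rule ev7_ne_0) (simp add: X7_Y7_P7_0)
  then show ?thesis
    using pull7_derivative e7q_ne_0
  proof eventually_elim
    case (elim t)
    have "ev7 K7 t * e7q t * deriv pull7 t
      = 128 * (ev7 K7 t * (ev7 (D7 X7) t * ev7 Y7 t - ev7 X7 t * ev7 (D7 Y7) t)) / ev7 Y7 t ^ 2"
      unfolding elim(2) using elim(3) by simp
    also have "ev7 K7 t * (ev7 (D7 X7) t * ev7 Y7 t - ev7 X7 t * ev7 (D7 Y7) t)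
        = ev7 P7 t * ev7 X7 t * ev7 Y7 t"
      using null7_eq[OF K7_P7_identity, of t] by (simp add: ev7_simps)
    also have "128 * (ev7 P7 t * ev7 X7 t * ev7 Y7 t) / ev7 Y7 t ^ 2 = ev7 P7 t * pull7 t"
      using elim(1) by (simp add: pull7_def power2_eq_square)
    finally show ?case by simp
  qed
qed

section \<open>The hypergeometric equation in the coordinate ring\<close>

text \<open>If \<open>\<theta> R = N / (14 P) R\<close>, then \<open>\<theta> (S / P\<^sup>k R) = step7 k N S / (14 P\<^sup>k\<^sup>+\<^sup>2) R\<close>.\<close>
definition step7 :: "int \<Rightarrow> e7 \<Rightarrow> e7 \<Rightarrow> e7" where
  "step7 k N S = const7 14 * K7 * (D7 S * P7 - const7 k * S * D7 P7) + N * S * P7"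

text \<open>The hypergeometric operator with parameters \<open>a\<^sub>i / 14\<close> and \<open>b\<^sub>i / 14\<close> applied to \<open>R\<close>, divided by \<open>R\<close>
  and cleared of denominators by means of \<open>(1 - \<Phi>\<^sub>7) Y F\<^sub>3 = (1 - 8 u) P\<^sup>2\<close>.\<close>
definition ode7 :: "e7 \<Rightarrow> int \<Rightarrow> int \<Rightarrow> int \<Rightarrow> int \<Rightarrow> int \<Rightarrow> e7" where
  "ode7 N a1 a2 a3 b1 b2 =
     (let S = step7 1 N N in
      E7 [1, -8] [] * step7 3 N S + E7 [1, -4] [-4] *
        ((const7 (b1 + b2 - 28) * Y7 - const7 (128 * (a1 + a2 + a3)) * X7) * S
         + (const7 ((b1 - 14) * (b2 - 14)) * Y7
              - const7 (128 * (a1 * a2 + a1 * a3 + a2 * a3)) * X7) * N * P7 ^ 2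
         - const7 (128 * (a1 * a2 * a3)) * X7 * P7 ^ 3))"

text \<open>Clearing denominators leaves y - 128 x in front of \<open>s3\<close>. By
  \<open>sq\<close>, that factor times \<open>f\<close> is \<open>a * p ^ 2\<close>, so a common
  \<open>p ^ 2\<close> splits off and the rest is \<open>num\<close>. The constants 14, 196, 2744
  are powers of 14.\<close>

lemma ode_from_numerators:
  fixes x y :: complex
  assumes nz: "y \<noteq> 0" "f \<noteq> 0" "p \<noteq> 0"
    and sq: "(y - 128 * x) * f = a * p ^ 2"
    and num: "a * s3 + f * ((14 * c2 * y - 128 * (14 * d2) * x) * s2
        + (196 * c1 * y - 128 * (196 * d1) * x) * n * p ^ 2 - 128 * (2744 * d0) * x * p ^ 3) = 0"
  shows "s3 / (2744 * p ^ 5) + c2 * (s2 / (196 * p ^ 3)) + c1 * (n / (14 * p))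
     = 128 * x / y * (s3 / (2744 * p ^ 5) + d2 * (s2 / (196 * p ^ 3)) + d1 * (n / (14 * p)) + d0)"
    (is "?l = ?r")
proof -
  have "2744 * p ^ 5 * y * f * (?l - ?r) =
      ((y - 128 * x) * f) * s3 + p ^ 2 * f * ((14 * c2 * y - 128 * (14 * d2) * x) * s2
        + (196 * c1 * y - 128 * (196 * d1) * x) * n * p ^ 2 - 128 * (2744 * d0) * x * p ^ 3)"
    using nz by (simp add: field_simps power_numeral_reduce)
  also have "\<dots> = p ^ 2 * (a * s3 + f * ((14 * c2 * y - 128 * (14 * d2) * x) * s2
        + (196 * c1 * y - 128 * (196 * d1) * x) * n * p ^ 2 - 128 * (2744 * d0) * x * p ^ 3))"
    unfolding sq by (simp add: algebra_simps)
  finally show ?thesis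
    using nz num by simp
qed

text \<open>Each application of \<theta> multiplies the constant \<open>c\<close> by 14 and raises
  the exponent of P by 2, so the form of the expression is preserved and the step can be
  iterated.\<close>

lemma pull7_euler_step:
  assumes R: "R analytic_on {0}"
    and dlog: "\<forall>\<^sub>F t in nhds 0. 14 * ev7 K7 t * e7q t * deriv R t = ev7 N t * R t"
  shows "\<forall>\<^sub>F t in nhds 0. pull7 t * deriv (\<lambda>t. ev7 S t / (c * ev7 P7 t ^ k) * R t) t
     = deriv pull7 t * (ev7 (step7 (int k) N S) t / ((14 * c) * ev7 P7 t ^ (k + 2)) * R t)"
proof -
  have "\<forall>\<^sub>F t in nhds 0. ev7 P7 t \<noteq> 0"
    by (rule ev7_ne_0) (simp add: X7_Y7_P7_0)
  then show ?thesis
    using ev7_derivative e7q_ne_0 dlog pull7_euler eventually_analytic_at[OF R]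
  proof eventually_elim
    case (elim t)
    define p dp s ds q K n r dr where "p = ev7 P7 t" and "dp = ev7 (D7 P7) t" and "s = ev7 S t"
      and "ds = ev7 (D7 S) t" and "q = e7q t" and "K = ev7 K7 t" and "n = ev7 N t"
      and "r = R t" and "dr = deriv R t"
    define d where "d = deriv (\<lambda>t. ev7 S t / (c * ev7 P7 t ^ k) * R t) t"
    note defs = p_def dp_def s_def ds_def q_def K_def n_def r_def dr_def
    show ?case
    \<comment> \<open>For \<open>c = 0\<close> both sides are 0 by the convention x / 0 = 0.\<close>
    proof (cases "c = 0")
      case False
      have "((\<lambda>t. ev7 S t / (c * ev7 P7 t ^ k) * R t) has_field_derivative
         (ds / q * (c * p ^ k) - s * (c * (of_nat k * (dp / q * p ^ (k - Suc 0))))) / ((c * p ^ k) * (c * p ^ k)) * r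
          + dr * (s / (c * p ^ k))) (at t)"
        unfolding defs using elim False
        by (intro DERIV_mult DERIV_divide DERIV_cmult DERIV_power analytic_derivI) auto
      then have d: "d =
         (ds / q * (c * p ^ k) - s * (c * (of_nat k * (dp / q * p ^ (k - Suc 0))))) / ((c * p ^ k) * (c * p ^ k)) * r
          + dr * (s / (c * p ^ k))"
        unfolding d_def by (rule DERIV_imp_deriv)
      have Kqd: "K * q * d = ev7 (step7 (int k) N S) t / ((14 * c) * p ^ (k + 1)) * r"
      proof -
        \<comment> \<open>For k = 0 the truncated exponent \<open>k - Suc 0\<close> is harmless,
          since the factor k is zero.\<close>
        have kp: "of_nat k * p ^ (k - Suc 0) = of_nat k * p ^ k / p"
          using elim(1) by (cases k) (simp_all add: p_def)
        \<comment> \<open>A factor 14 is inserted in the last summand so that \<open>dlog\<close>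
          can replace \<open>14 * K * q * dr\<close> by \<open>n * r\<close>.\<close>
        have "K * q * d = K * q * ((ds / q * (c * p ^ k) - s * (c * (dp / q * (of_nat k * p ^ (k - Suc 0)))))
            / ((c * p ^ k) * (c * p ^ k)) * r) + (14 * K * q * dr) * (s / (14 * c * p ^ k))"
          unfolding d using False elim(1) by (simp add: field_simps p_def)
        also have "14 * K * q * dr = n * r"
          using elim(4) by (simp add: defs)
        also have "K * q * ((ds / q * (c * p ^ k) - s * (c * (dp / q * (of_nat k * p ^ (k - Suc 0)))))
            / ((c * p ^ k) * (c * p ^ k)) * r) + n * r * (s / (14 * c * p ^ k))
           = (14 * K * (ds * p - of_nat k * s * dp) + n * s * p) / (14 * c * p ^ (k + 1)) * r"
          unfolding kp using False elim(1,3) by (simp add: p_def[symmetric] q_def[symmetric] divide_simps) (simp add: algebra_simps)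
        also have "14 * K * (ds * p - of_nat k * s * dp) + n * s * p = ev7 (step7 (int k) N S) t"
          by (simp add: step7_def ev7_simps defs)
        finally show ?thesis by simp
      qed
      have "pull7 t = K * q * deriv pull7 t / p"
        using elim(1,5) by (simp add: defs field_simps)
      then have "pull7 t * d = deriv pull7 t * (K * q * d) / p"
        by simp
      then show ?thesis
        unfolding Kqd by (simp add: d_def p_def r_def mult_ac)
    qed simp
  qed
qed

text \<open>Starting from \<theta> R = N / (14 P) R, two further Euler steps express all derivatives
  as rational multiples of R. The differential equation thus becomes the single ring identity
  \<open>ode\<close>. Positivity of \<open>b1\<close> and \<open>b2\<close> keeps the lower
  parameters off the non-positive integers.\<close>

lemma hyp3F2_pull7:
  assumes R: "R analytic_on {0}" "R 0 = 1"
    and dlog: "\<forall>\<^sub>F t in nhds 0. 14 * ev7 K7 t * e7q t * deriv R t = ev7 N t * R t"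
    and ode: "null7 (ode7 N a1 a2 a3 b1 b2)"
    and b: "b1 > 0" "b2 > 0"
  shows "\<forall>\<^sub>F t in nhds 0. hyp3F2 (of_int a1 / 14) (of_int a2 / 14) (of_int a3 / 14)
           (of_int b1 / 14) (of_int b2 / 14) (pull7 t) = R t"
proof -
  define S2 where "S2 = step7 1 N N"
  define S3 where "S3 = step7 3 N S2"
  have bnz: "of_int b / 14 + of_nat n \<noteq> (0::complex)" if "b > 0" for b :: int and n :: nat
  proof
    assume "of_int b / 14 + of_nat n = (0::complex)"
    then have "(of_int (b + 14 * int n) :: complex) = 0" by (simp add: field_simps)
    then show False using that by (simp only: of_int_eq_0_iff)
  qed
  have P0: "ev7 P7 0 \<noteq> 0" by (simp add: X7_Y7_P7_0)
  show ?thesis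
  proof (rule hyp3F2_pullback[where ?R1.0 = "\<lambda>t. ev7 N t / (14 * ev7 P7 t ^ 1) * R t"
        and ?R2.0 = "\<lambda>t. ev7 S2 t / (196 * ev7 P7 t ^ 3) * R t"
        and ?R3.0 = "\<lambda>t. ev7 S3 t / (2744 * ev7 P7 t ^ 5) * R t"])
    show "\<forall>\<^sub>F t in nhds 0. pull7 t * deriv R t = deriv pull7 t * (ev7 N t / (14 * ev7 P7 t ^ 1) * R t)"
      using dlog pull7_euler e7q_ne_0 ev7_ne_0[OF P0]
    proof eventually_elim
      case (elim t)
      have "14 * ev7 P7 t * (pull7 t * deriv R t)
          = (14 * ev7 K7 t * e7q t * deriv R t) * deriv pull7 t"
        using elim(2) by (simp add: mult_ac)
      then show ?case
        unfolding elim(1) using elim(4) by (simp add: field_simps)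
    qed
    show "\<forall>\<^sub>F t in nhds 0. pull7 t * deriv (\<lambda>t. ev7 N t / (14 * ev7 P7 t ^ 1) * R t) t
        = deriv pull7 t * (ev7 S2 t / (196 * ev7 P7 t ^ 3) * R t)"
      using pull7_euler_step[OF R(1) dlog, of N 14 1] by (simp add: S2_def power3_eq_cube mult.assoc)
    show "\<forall>\<^sub>F t in nhds 0. pull7 t * deriv (\<lambda>t. ev7 S2 t / (196 * ev7 P7 t ^ 3) * R t) t
        = deriv pull7 t * (ev7 S3 t / (2744 * ev7 P7 t ^ 5) * R t)"
      using pull7_euler_step[OF R(1) dlog, of S2 196 3] by (simp add: S3_def)
    have "\<forall>\<^sub>F t in nhds 0. ev7 Y7 t \<noteq> 0" "\<forall>\<^sub>F t in nhds 0. ev7 (E7 [1, -4] [-4]) t \<noteq> 0"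
      by (rule ev7_ne_0; simp add: X7_Y7_P7_0)+
    then show "\<forall>\<^sub>F t in nhds 0. ev7 S3 t / (2744 * ev7 P7 t ^ 5) * R t
        + (of_int b1 / 14 + of_int b2 / 14 - 2) * (ev7 S2 t / (196 * ev7 P7 t ^ 3) * R t)
        + (of_int b1 / 14 - 1) * (of_int b2 / 14 - 1) * (ev7 N t / (14 * ev7 P7 t ^ 1) * R t)
      = pull7 t * (ev7 S3 t / (2744 * ev7 P7 t ^ 5) * R t
        + (of_int a1 / 14 + of_int a2 / 14 + of_int a3 / 14) * (ev7 S2 t / (196 * ev7 P7 t ^ 3) * R t)
        + (of_int a1 / 14 * (of_int a2 / 14) + of_int a1 / 14 * (of_int a3 / 14)
           + of_int a2 / 14 * (of_int a3 / 14)) * (ev7 N t / (14 * ev7 P7 t ^ 1) * R t)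
        + of_int a1 / 14 * (of_int a2 / 14) * (of_int a3 / 14) * R t)"
      using ev7_ne_0[OF P0]
    proof eventually_elim
      case (elim t)
      define c2 c1 d2 d1 d0 :: complex where "c2 = of_int b1 / 14 + of_int b2 / 14 - 2"
        and "c1 = (of_int b1 / 14 - 1) * (of_int b2 / 14 - 1)"
        and "d2 = of_int a1 / 14 + of_int a2 / 14 + of_int a3 / 14"
        and "d1 = of_int a1 / 14 * (of_int a2 / 14) + of_int a1 / 14 * (of_int a3 / 14)
           + of_int a2 / 14 * (of_int a3 / 14)"
        and "d0 = of_int a1 / 14 * (of_int a2 / 14) * (of_int a3 / 14)"
      \<comment> \<open>Powers of 14 turn the coefficients of the operator into the integers
        occurring in \<open>ode7\<close>.\<close>
      have c: "14 * c2 = of_int (b1 + b2 - 28)" "196 * c1 = of_int ((b1 - 14) * (b2 - 14))"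
        "128 * (14 * d2) = of_int (128 * (a1 + a2 + a3))"
        "128 * (196 * d1) = of_int (128 * (a1 * a2 + a1 * a3 + a2 * a3))"
        "128 * (2744 * d0) = of_int (128 * (a1 * a2 * a3))"
        by (simp_all add: c2_def c1_def d2_def d1_def d0_def field_simps)
      have "ev7 (ode7 N a1 a2 a3 b1 b2) t = 0"
        using ode by (cases "ode7 N a1 a2 a3 b1 b2") (auto simp: lev_null)
      then have num: "ev7 (E7 [1, -8] []) t * ev7 S3 t + ev7 (E7 [1, -4] [-4]) t *
          ((14 * c2 * ev7 Y7 t - 128 * (14 * d2) * ev7 X7 t) * ev7 S2 t
        + (196 * c1 * ev7 Y7 t - 128 * (196 * d1) * ev7 X7 t) * ev7 N t * ev7 P7 t ^ 2
        - 128 * (2744 * d0) * ev7 X7 t * ev7 P7 t ^ 3) = 0"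
        unfolding c ode7_def Let_def S2_def[symmetric] S3_def[symmetric]
        by (simp only: ev7_simps)
      have sq: "(ev7 Y7 t - 128 * ev7 X7 t) * ev7 (E7 [1, -4] [-4]) t = ev7 (E7 [1, -8] []) t * ev7 P7 t ^ 2"
        using null7_eq[OF P7_squared_identity, of t] by (simp only: ev7_simps of_int_numeral)
      have "ev7 S3 t / (2744 * ev7 P7 t ^ 5) + c2 * (ev7 S2 t / (196 * ev7 P7 t ^ 3))
            + c1 * (ev7 N t / (14 * ev7 P7 t))
         = pull7 t * (ev7 S3 t / (2744 * ev7 P7 t ^ 5) + d2 * (ev7 S2 t / (196 * ev7 P7 t ^ 3))
            + d1 * (ev7 N t / (14 * ev7 P7 t)) + d0)"
        unfolding pull7_def by (rule ode_from_numerators[OF elim sq num])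
      then have "(ev7 S3 t / (2744 * ev7 P7 t ^ 5) + c2 * (ev7 S2 t / (196 * ev7 P7 t ^ 3))
            + c1 * (ev7 N t / (14 * ev7 P7 t))) * R t
         = pull7 t * (ev7 S3 t / (2744 * ev7 P7 t ^ 5) + d2 * (ev7 S2 t / (196 * ev7 P7 t ^ 3))
            + d1 * (ev7 N t / (14 * ev7 P7 t)) + d0) * R t"
        by simp
      then show ?case
        unfolding c2_def[symmetric] c1_def[symmetric] d2_def[symmetric] d1_def[symmetric] d0_def[symmetric]
        by (simp only: distrib_right distrib_left power_one_right mult.assoc)
    qed
  qed (use bnz b R P0 in \<open>auto intro!: analytic_intros pull7_analytic deriv_pull7_0 simp: pull7_0\<close>)
qed

section \<open>Products of powers on the curve\<close>

text \<open>Numerator and denominator of \<open>D g / g\<close> for \<open>g = \<Prod> f\<^sub>i ^ m\<^sub>i\<close>.\<close>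
primrec dlog7 :: "(int \<times> e7) list \<Rightarrow> e7 \<times> e7" where
  "dlog7 [] = (const7 0, 1)"
| "dlog7 (x # xs) = (case dlog7 xs of (a, b) \<Rightarrow>
     (const7 (fst x) * D7 (snd x) * b + snd x * a, snd x * b))"

definition prod7 :: "(int \<times> e7) list \<Rightarrow> complex \<Rightarrow> complex" where
  "prod7 xs t = (\<Prod>x\<leftarrow>xs. ev7 (snd x) t powi fst x)"

text \<open>Each induction step puts m Df / f + a / b on the common denominator f b; nonvanishing is
  carried along to justify the division.\<close>

lemma prod7_dlog7:
  assumes "\<forall>x\<in>set xs. ev7 (snd x) t \<noteq> 0" "e7q t \<noteq> 0"
    and der: "\<And>x. (ev7 x has_field_derivative ev7 (D7 x) t / e7q t) (at t)"
  shows "ev7 (snd (dlog7 xs)) t \<noteq> 0 \<and> prod7 xs t \<noteq> 0 \<and>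
    (prod7 xs has_field_derivative
       prod7 xs t * (ev7 (fst (dlog7 xs)) t / (ev7 (snd (dlog7 xs)) t * e7q t))) (at t)"
  using assms(1)
proof (induction xs)
  case Nil
  then show ?case by (simp add: prod7_def[abs_def] ev7_simps)
next
  case (Cons x xs)
  obtain m f where x: "x = (m, f)" by fastforce
  obtain a b where ab: "dlog7 xs = (a, b)" by fastforce
  have nz: "ev7 f t \<noteq> 0" "ev7 b t \<noteq> 0" "prod7 xs t \<noteq> 0"
    and IH: "(prod7 xs has_field_derivative prod7 xs t * (ev7 a t / (ev7 b t * e7q t))) (at t)"
    using Cons x ab by auto
  have eq: "prod7 (x # xs) = (\<lambda>t. ev7 f t powi m * prod7 xs t)"
    by (simp add: prod7_def fun_eq_iff x)
  have "((\<lambda>t. ev7 f t powi m) has_field_derivative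
      of_int m * (ev7 f t powi m / ev7 f t) * (ev7 (D7 f) t / e7q t)) (at t)"
    using nz(1) by (auto intro!: derivative_eq_intros der simp: power_int_diff)
  from DERIV_mult[OF this IH]
  have "(prod7 (x # xs) has_field_derivative prod7 (x # xs) t
      * ((of_int m * ev7 (D7 f) t * ev7 b t + ev7 f t * ev7 a t) / (ev7 f t * ev7 b t * e7q t))) (at t)"
    unfolding eq by (rule DERIV_cong) (use nz assms(2) in \<open>simp add: field_simps\<close>)
  then show ?case
    using nz by (simp add: x ab eq[unfolded x] ev7_simps)
qed

lemma prod7_analytic:
  assumes "\<And>x. x \<in> set xs \<Longrightarrow> ev7 (snd x) 0 \<noteq> 0"
  shows "prod7 xs analytic_on {0}"
  using assms
proof (induction xs)
  case (Cons x xs)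
  have "prod7 (x # xs) = (\<lambda>t. ev7 (snd x) t powi fst x * prod7 xs t)"
    by (simp add: prod7_def fun_eq_iff)
  moreover have "ev7 (snd x) 0 \<noteq> 0" "prod7 xs analytic_on {0}"
    using Cons by auto
  ultimately show ?case
    by (auto intro!: analytic_intros)
qed (simp add: prod7_def[abs_def])

text \<open>\<open>Q\<close> is the analytic continuation of the product across t = 0, where single
  factors may vanish or have poles. Its 14th root R satisfies 14 R' / R = n / (d q), with n / d the
  fraction from \<open>dlog7\<close>; by \<open>dlog\<close>, K n = N d, which is the first-order
  equation that \<open>hyp3F2_pull7\<close> requires.\<close>

lemma hyp3F2_e7_solution:
  assumes Q: "Q analytic_on {0}" "Q 0 = 1" "\<forall>\<^sub>F t in at 0. Q t = prod7 fs t"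
    and nz: "\<And>x. x \<in> set fs \<Longrightarrow> \<forall>\<^sub>F t in at 0. ev7 (snd x) t \<noteq> 0"
    and dlog: "null7 (K7 * fst (dlog7 fs) - N * snd (dlog7 fs))"
    and ode: "null7 (ode7 N a1 a2 a3 b1 b2)"
    and b: "b1 > 0" "b2 > 0"
  obtains R where "R analytic_on {0}" "R 0 = 1"
    "\<forall>\<^sub>F t in at 0. R t ^ 14 = prod7 fs t \<and> hyp3F2 (of_int a1 / 14) (of_int a2 / 14) (of_int a3 / 14)
       (of_int b1 / 14) (of_int b2 / 14) (Phi7 (e7u t) (e7v t)) = R t"
proof
  \<comment> \<open>As \<open>Q 0 = 1\<close>, the principal logarithm is analytic near the value
    and selects the branch with \<open>R 0 = 1\<close>.\<close>
  define R where "R t = exp (Ln (Q t) / 14)" for t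
  show R: "R analytic_on {0}"
    unfolding R_def by (intro analytic_intros Q) (simp_all add: Q(2))
  show R0: "R 0 = 1" by (simp add: R_def Q(2))
  have "\<forall>\<^sub>F t in nhds 0. Q t \<noteq> 0"
    by (rule eventually_analytic_ne_0[OF Q(1)]) (simp add: Q(2))
  then have R14: "\<forall>\<^sub>F t in nhds 0. R t ^ 14 = Q t"
  proof eventually_elim
    case (elim t)
    have "R t ^ 14 = exp (of_nat 14 * (Ln (Q t) / 14))"
      unfolding R_def by (rule exp_of_nat_mult[symmetric])
    then show ?case using elim by simp
  qed
  have nz': "\<forall>\<^sub>F t in at 0. \<forall>x\<in>set fs. ev7 (snd x) t \<noteq> 0"
    using nz by (simp add: eventually_ball_finite_distrib)
  have R14p: "\<forall>\<^sub>F t in at 0. R t ^ 14 = prod7 fs t"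
    using eventually_at_0[OF R14] Q(3) by eventually_elim simp
  have "\<forall>\<^sub>F t in at 0. \<forall>\<^sub>F s in nhds t. R s ^ 14 = prod7 fs s"
    by (rule eventually_at_eventually_nhds[OF R14p])
  then have "\<forall>\<^sub>F t in at 0. 14 * ev7 K7 t * e7q t * deriv R t = ev7 N t * R t"
    using nz' R14p eventually_at_0[OF ev7_derivative] eventually_at_0[OF e7q_ne_0]
      eventually_at_0[OF eventually_analytic_at[OF R]]
  proof eventually_elim
    case (elim t)
    define n d where "n = ev7 (fst (dlog7 fs)) t" and "d = ev7 (snd (dlog7 fs)) t"
    have p: "d \<noteq> 0" "(prod7 fs has_field_derivative prod7 fs t * (n / (d * e7q t))) (at t)"
      using prod7_dlog7[of fs t] elim unfolding n_def d_def by auto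
    have "R t \<noteq> 0" by (simp add: R_def)
    have "((\<lambda>t. R t ^ 14) has_field_derivative of_nat 14 * (deriv R t * R t ^ (14 - Suc 0))) (at t)"
      by (intro DERIV_power analytic_derivI elim)
    moreover have "((\<lambda>t. R t ^ 14) has_field_derivative prod7 fs t * (n / (d * e7q t))) (at t)"
      using p(2) DERIV_cong_ev[OF refl elim(1) refl] by blast
    ultimately have "14 * (deriv R t * R t ^ 13) = R t ^ 14 * (n / (d * e7q t))"
      using DERIV_unique elim(3) by fastforce
    also have "R t ^ 14 = R t * R t ^ 13"
      by (simp add: power_numeral_reduce)
    finally have "R t ^ 13 * (14 * deriv R t) = R t ^ 13 * (R t * n / (d * e7q t))"
      by (simp add: mult_ac)
    then have "14 * deriv R t = R t * n / (d * e7q t)"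
      using \<open>R t \<noteq> 0\<close> by (simp only: mult_cancel_left power_eq_0_iff) simp
    then have "14 * ev7 K7 t * e7q t * deriv R t = (ev7 K7 t * n) * R t / d"
      using elim(5) p(1) by (simp add: field_simps)
    also have "ev7 K7 t * n = ev7 N t * d"
      using null7_eq[OF dlog, of t] by (simp add: ev7_simps n_def d_def)
    finally show ?case using p(1) by simp
  qed
  \<comment> \<open>Both sides are analytic, so the equation extends to t = 0.\<close>
  then have "\<forall>\<^sub>F t in nhds 0. 14 * ev7 K7 t * e7q t * deriv R t = ev7 N t * R t"
    by (intro eventually_nhds_analytic_eq) (auto intro!: analytic_intros R)
  from eventually_at_0[OF hyp3F2_pull7[OF R R0 this ode b]] R14p Phi7_eq_pull7
  show "\<forall>\<^sub>F t in at 0. R t ^ 14 = prod7 fs t \<and> hyp3F2 (of_int a1 / 14) (of_int a2 / 14) (of_int a3 / 14)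
       (of_int b1 / 14) (of_int b2 / 14) (Phi7 (e7u t) (e7v t)) = R t"
    by eventually_elim simp
qed

section \<open>The three evaluations\<close>

text \<open>For the \<open>k\<close>-th right-hand side \<open>R\<close>: \<open>factors7_k\<close> encodes \<open>R ^ 14\<close> as a product of powers, and
  \<open>N7_k = 14 P \<theta> R / R\<close>, which is a polynomial because \<open>\<theta> R / R\<close> is regular off \<open>\<Phi>\<^sub>7 = 1\<close>.\<close>
definition N7_1 :: e7 where
  "N7_1 = E7 [0, -88, 2160, -21824, 115712, -319488, 344064] [-24, 272, 1216, -23552, 73728, -16384]"

definition factors7_1 :: "(int \<times> e7) list" where
  "factors7_1 =
    [(2, E7 [1, -4] []),
     (8, E7 [1, -8] []),
     (4, E7 [1, -6] [-2]),
     (-1, E7 [1, -4] [-4]),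
     (-7, E7 [1, -20, 64] [-4])]"

text \<open>Certifies that \<open>N7_1\<close> is K times the logarithmic derivative of the product
  under \<open>D7\<close>.\<close>

lemma dlog7_identity_1: "null7 (K7 * fst (dlog7 factors7_1) - N7_1 * snd (dlog7 factors7_1))"
  by code_simp

lemma ode7_identity_1: "null7 (ode7 N7_1 (-1) 1 9 4 12)"
  by code_simp

definition N7_2 :: e7 where
  "N7_2 = E7 [0, -44, -880, 30528, -279040, 1073152, -1490944] [44, -368, -960, 16896, -49152, 49152]"

definition factors7_2 :: "(int \<times> e7) list" where
  "factors7_2 =
    [(1, E7 [1, -8] []),
     (12, E7 [1, -6] [2]),
     (7, E7 [1, -20, 64] [-4]),
     (-2, E7 [1, -4] []),
     (-3, E7 [1, -4] [4]),
     (-14, E7 [1, -10, 16] [2])]"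

lemma dlog7_identity_2: "null7 (K7 * fst (dlog7 factors7_2) - N7_2 * snd (dlog7 factors7_2))"
  by code_simp

lemma ode7_identity_2: "null7 (ode7 N7_2 1 3 11 6 16)"
  by code_simp

definition N7_3 :: e7 where
  "N7_3 = E7 [0, -568, 6560, 31168, -772096, 3948544, -6537216] [456, -7072, 30656, 3072, -253952, 311296]"

definition factors7_3 :: "(int \<times> e7) list" where
  "factors7_3 =
    [(14, E7 [1, -8] []),
     (1, E7 [1, -4] [4]),
     (63, E7 [0, -5, 24] [1, -8]),
     (-26, E7 [0, 1] []),
     (-3, E7 [0, -1] [1]),
     (-8, E7 [0, 1] [1]),
     (-70, E7 [1, -10, 16] [2])]"

lemma dlog7_identity_3: "null7 (K7 * fst (dlog7 factors7_3) - N7_3 * snd (dlog7 factors7_3))"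
  by code_simp

lemma ode7_identity_3: "null7 (ode7 N7_3 9 11 19 22 24)"
  by code_simp

section \<open>From ring identities to the stated closed forms\<close>

lemma ev7_factors:
  "ev7 (E7 [1, -4] []) t = 1 - 4 * e7u t"
  "ev7 (E7 [1, -8] []) t = 1 - 8 * e7u t"
  "ev7 (E7 [1, -4] [-4]) t = F3 (e7u t) (e7v t)"
  "ev7 (E7 [1, -4] [4]) t = F3t (e7u t) (e7v t)"
  "ev7 (E7 [1, -6] [-2]) t = F4 (e7u t) (e7v t)"
  "ev7 (E7 [1, -6] [2]) t = F4t (e7u t) (e7v t)"
  "ev7 (E7 [1, -10, 16] [2]) t = G3 (e7u t) (e7v t)"
  "ev7 (E7 [1, -20, 64] [-4]) t = G4 (e7u t) (e7v t)"
  "ev7 (E7 [0, -5, 24] [1, -8]) t = G4h (e7u t) (e7v t)"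
  "ev7 (E7 [0, 1] []) t = e7u t"
  "ev7 (E7 [0, -1] [1]) t = e7v t - e7u t"
  "ev7 (E7 [0, 1] [1]) t = e7v t + e7u t"
  by (simp_all add: F3_def F3t_def F4_def F4t_def G3_def G4_def G4h_def power2_eq_square algebra_simps)

lemma prod7_factors7_1:
  "prod7 factors7_1 t = (let u = e7u t; v = e7v t in
     ((1 - 4 * u)^2 * (1 - 8 * u)^8 * F4 u v ^ 4) / (F3 u v * G4 u v ^ 7))"
  by (simp add: factors7_1_def prod7_def ev7_factors power_int_minus divide_inverse Let_def mult_ac
        del: ev7.simps)

lemma prod7_factors7_2:
  "prod7 factors7_2 t = (let u = e7u t; v = e7v t in
     ((1 - 8 * u) * F4t u v ^ 12 * G4 u v ^ 7) / ((1 - 4 * u)^2 * F3t u v ^ 3 * G3 u v ^ 14))"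
  by (simp add: factors7_2_def prod7_def ev7_factors power_int_minus divide_inverse Let_def mult_ac
        del: ev7.simps)

lemma prod7_factors7_3:
  "prod7 factors7_3 t = (let u = e7u t; v = e7v t in
     ((1 - 8 * u) ^ 14 * F3t u v * G4h u v ^ 63) / (u ^ 26 * (v - u) ^ 3 * (v + u) ^ 8 * G3 u v ^ 70))"
  by (simp add: factors7_3_def prod7_def ev7_factors power_int_minus divide_inverse Let_def mult_ac
        del: ev7.simps)

text \<open>Every factor equals 1 at the origin, so the product itself is analytic there and serves
  as \<open>Q\<close>.\<close>

lemma hyp3F2_E7_evaluation_1:
  "\<exists>r>0. \<exists>R. R holomorphic_on ball 0 r \<and> R 0 = 1 \<and>
      (\<forall>t\<in>ball 0 r. t \<noteq> 0 \<longrightarrow>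
         (let u = e7u t; v = e7v t in
            R t ^ 14 * F3 u v * G4 u v ^ 7 = (1 - 4 * u)^2 * (1 - 8 * u)^8 * F4 u v ^ 4 \<and>
            hyp3F2 (-1/14) (1/14) (9/14) (2/7) (6/7) (Phi7 u v) = R t))"
proof -
  have nz: "\<forall>\<^sub>F t in at 0. ev7 (snd x) t \<noteq> 0" if "x \<in> set factors7_1" for x
    using that by (intro eventually_at_0 ev7_ne_0) (auto simp: factors7_1_def)
  obtain R where R: "R analytic_on {0}" "R 0 = 1"
    "\<forall>\<^sub>F t in at 0. R t ^ 14 = prod7 factors7_1 t \<and>
       hyp3F2 (of_int (-1) / 14) (of_int 1 / 14) (of_int 9 / 14)
         (of_int 4 / 14) (of_int 12 / 14) (Phi7 (e7u t) (e7v t)) = R t"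
  proof (rule hyp3F2_e7_solution[OF _ _ _ nz dlog7_identity_1 ode7_identity_1])
    show "prod7 factors7_1 analytic_on {0}"
      by (rule prod7_analytic) (auto simp: factors7_1_def)
    show "prod7 factors7_1 0 = 1"
      by (simp add: factors7_1_def prod7_def)
  qed auto
  have "\<forall>\<^sub>F t in at 0. \<forall>x\<in>set factors7_1. ev7 (snd x) t \<noteq> 0"
    using nz by (simp add: eventually_ball_finite_distrib)
  with R(3) have "\<forall>\<^sub>F t in at 0. let u = e7u t; v = e7v t in
            R t ^ 14 * F3 u v * G4 u v ^ 7 = (1 - 4 * u)^2 * (1 - 8 * u)^8 * F4 u v ^ 4 \<and>
            hyp3F2 (-1/14) (1/14) (9/14) (2/7) (6/7) (Phi7 u v) = R t"
  proof eventually_elim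
    case (elim t)
    define u v where "u = e7u t" and "v = e7v t"
    have "F3 u v * G4 u v ^ 7 \<noteq> 0"
      using elim(2) by (simp add: factors7_1_def ev7_factors u_def v_def del: ev7.simps)
    moreover have "R t ^ 14 = ((1 - 4 * u)^2 * (1 - 8 * u)^8 * F4 u v ^ 4) / (F3 u v * G4 u v ^ 7)"
      using elim(1) by (simp add: prod7_factors7_1 Let_def u_def v_def)
    ultimately have "R t ^ 14 * (F3 u v * G4 u v ^ 7) = (1 - 4 * u)^2 * (1 - 8 * u)^8 * F4 u v ^ 4"
      by (metis nonzero_divide_eq_eq)
    then show ?case
      using elim(1) by (simp add: Let_def u_def v_def mult.assoc)
  qed
  then show ?thesis
    by (rule analytic_at_0_ballI[OF R(1,2)])
qed

lemma hyp3F2_E7_evaluation_2: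
  "\<exists>r>0. \<exists>R. R holomorphic_on ball 0 r \<and> R 0 = 1 \<and>
      (\<forall>t\<in>ball 0 r. t \<noteq> 0 \<longrightarrow>
         (let u = e7u t; v = e7v t in
            R t ^ 14 * (1 - 4 * u)^2 * F3t u v ^ 3 * G3 u v ^ 14
              = (1 - 8 * u) * F4t u v ^ 12 * G4 u v ^ 7 \<and>
            hyp3F2 (1/14) (3/14) (11/14) (3/7) (8/7) (Phi7 u v) = R t))"
proof -
  have nz: "\<forall>\<^sub>F t in at 0. ev7 (snd x) t \<noteq> 0" if "x \<in> set factors7_2" for x
    using that by (intro eventually_at_0 ev7_ne_0) (auto simp: factors7_2_def)
  obtain R where R: "R analytic_on {0}" "R 0 = 1"
    "\<forall>\<^sub>F t in at 0. R t ^ 14 = prod7 factors7_2 t \<and>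
       hyp3F2 (of_int 1 / 14) (of_int 3 / 14) (of_int 11 / 14)
         (of_int 6 / 14) (of_int 16 / 14) (Phi7 (e7u t) (e7v t)) = R t"
  proof (rule hyp3F2_e7_solution[OF _ _ _ nz dlog7_identity_2 ode7_identity_2])
    show "prod7 factors7_2 analytic_on {0}"
      by (rule prod7_analytic) (auto simp: factors7_2_def)
    show "prod7 factors7_2 0 = 1"
      by (simp add: factors7_2_def prod7_def)
  qed auto
  have "\<forall>\<^sub>F t in at 0. \<forall>x\<in>set factors7_2. ev7 (snd x) t \<noteq> 0"
    using nz by (simp add: eventually_ball_finite_distrib)
  with R(3) have "\<forall>\<^sub>F t in at 0. let u = e7u t; v = e7v t in
            R t ^ 14 * (1 - 4 * u)^2 * F3t u v ^ 3 * G3 u v ^ 14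
              = (1 - 8 * u) * F4t u v ^ 12 * G4 u v ^ 7 \<and>
            hyp3F2 (1/14) (3/14) (11/14) (3/7) (8/7) (Phi7 u v) = R t"
  proof eventually_elim
    case (elim t)
    define u v where "u = e7u t" and "v = e7v t"
    have "(1 - 4 * u)^2 * F3t u v ^ 3 * G3 u v ^ 14 \<noteq> 0"
      using elim(2) by (simp add: factors7_2_def ev7_factors u_def v_def del: ev7.simps)
    moreover have "R t ^ 14 = ((1 - 8 * u) * F4t u v ^ 12 * G4 u v ^ 7) / ((1 - 4 * u)^2 * F3t u v ^ 3 * G3 u v ^ 14)"
      using elim(1) by (simp add: prod7_factors7_2 Let_def u_def v_def)
    ultimately have "R t ^ 14 * ((1 - 4 * u)^2 * F3t u v ^ 3 * G3 u v ^ 14) = (1 - 8 * u) * F4t u v ^ 12 * G4 u v ^ 7"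
      by (metis nonzero_divide_eq_eq)
    then show ?case
      using elim(1) by (simp add: Let_def u_def v_def mult.assoc)
  qed
  then show ?thesis
    by (rule analytic_at_0_ballI[OF R(1,2)])
qed

text \<open>Here u vanishes to order 2 in t, and v - u, v + u and \<open>G4h\<close> to order 1. The
  orders cancel, 63 - 2 * 26 - 3 - 8 = 0, so the product extends to the origin with value 1.\<close>

lemma hyp3F2_E7_evaluation_3:
  "\<exists>r>0. \<exists>R. R holomorphic_on ball 0 r \<and> R 0 = 1 \<and>
      (\<forall>t\<in>ball 0 r. t \<noteq> 0 \<longrightarrow>
         (let u = e7u t; v = e7v t in
            R t ^ 14 * u ^ 26 * (v - u) ^ 3 * (v + u) ^ 8 * G3 u v ^ 70
              = (1 - 8 * u) ^ 14 * F3t u v * G4h u v ^ 63 \<and>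
            hyp3F2 (9/14) (11/14) (19/14) (11/7) (12/7) (Phi7 u v) = R t))"
proof -
  define g where "g t = e7q t - 5 * t - 8 * t ^ 2 * e7q t + 24 * t ^ 3" for t
  have eqs: "G4h (e7u t) (e7v t) = t * g t" "e7v t - e7u t = t * (e7q t - t)"
    "e7v t + e7u t = t * (e7q t + t)" for t
    by (simp_all add: G4h_def g_def e7v_eq e7u_def algebra_simps power_numeral_reduce)
  have g: "g analytic_on {0}" "g 0 = 1"
    unfolding g_def by (auto intro!: analytic_intros)
  have unit: "\<forall>\<^sub>F t in at 0. f t \<noteq> 0" if "f analytic_on {0}" "f 0 = 1" for f :: "complex \<Rightarrow> complex"
    using that by (intro eventually_at_0 eventually_analytic_ne_0) auto
  have nzs: "\<forall>\<^sub>F t in at 0. g t \<noteq> 0" "\<forall>\<^sub>F t in at 0. e7q t - t \<noteq> 0" "\<forall>\<^sub>F t in at 0. e7q t + t \<noteq> 0"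
    by (rule unit; auto intro!: analytic_intros g)+
  have nz: "\<forall>\<^sub>F t in at 0. ev7 (snd x) t \<noteq> 0" if "x \<in> set factors7_3" for x
  proof -
    have "\<forall>\<^sub>F t in at 0. ev7 (E7 [0, -5, 24] [1, -8]) t \<noteq> 0 \<and> ev7 (E7 [0, 1] []) t \<noteq> 0
        \<and> ev7 (E7 [0, -1] [1]) t \<noteq> 0 \<and> ev7 (E7 [0, 1] [1]) t \<noteq> 0"
      unfolding ev7_factors eqs using nzs eventually_ne_0
      by eventually_elim (simp add: e7u_def)
    moreover have "\<forall>\<^sub>F t in at 0. ev7 (E7 [1, -8] []) t \<noteq> 0" "\<forall>\<^sub>F t in at 0. ev7 (E7 [1, -4] [4]) t \<noteq> 0"
      "\<forall>\<^sub>F t in at 0. ev7 (E7 [1, -10, 16] [2]) t \<noteq> 0"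
      by (intro eventually_at_0 ev7_ne_0; simp)+
    ultimately show ?thesis
      using that unfolding factors7_3_def by (auto elim: eventually_mono)
  qed
  \<comment> \<open>The product with the powers of t removed: \<open>g\<close>,
    \<open>e7q t - t\<close> and \<open>e7q t + t\<close> are the unit parts of the vanishing
    factors.\<close>
  define Q where "Q t = ev7 (E7 [1, -8] []) t ^ 14 * ev7 (E7 [1, -4] [4]) t * g t ^ 63
      / ((e7q t - t) ^ 3 * (e7q t + t) ^ 8 * ev7 (E7 [1, -10, 16] [2]) t ^ 70)" for t
  have nz': "\<forall>\<^sub>F t in at 0. \<forall>x\<in>set factors7_3. ev7 (snd x) t \<noteq> 0"
    using nz by (simp add: eventually_ball_finite_distrib)
  obtain R where R: "R analytic_on {0}" "R 0 = 1"
    "\<forall>\<^sub>F t in at 0. R t ^ 14 = prod7 factors7_3 t \<and>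
       hyp3F2 (of_int 9 / 14) (of_int 11 / 14) (of_int 19 / 14)
         (of_int 22 / 14) (of_int 24 / 14) (Phi7 (e7u t) (e7v t)) = R t"
  proof (rule hyp3F2_e7_solution[OF _ _ _ nz dlog7_identity_3 ode7_identity_3])
    show "Q analytic_on {0}"
      unfolding Q_def by (intro analytic_intros g) auto
    show "Q 0 = 1"
      by (simp add: Q_def g)
    show "\<forall>\<^sub>F t in at 0. Q t = prod7 factors7_3 t"
      using nz' nzs eventually_ne_0
    proof eventually_elim
      case (elim t)
      define a b c d e h where "a = ev7 (E7 [1, -8] []) t" and "b = ev7 (E7 [1, -4] [4]) t"
        and "c = g t" and "d = e7q t - t" and "e = e7q t + t" and "h = ev7 (E7 [1, -10, 16] [2]) t"
      have "prod7 factors7_3 t = a ^ 14 * (b * ((t * c) ^ 63 * (inverse ((t ^ 2) ^ 26)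
          * (inverse ((t * d) ^ 3) * (inverse ((t * e) ^ 8) * inverse (h ^ 70))))))"
        using eqs[of t] unfolding a_def b_def c_def d_def e_def h_def
        by (simp add: factors7_3_def prod7_def power_int_minus ev7_factors e7u_def del: ev7.simps)
      also have "\<dots> = a ^ 14 * b * c ^ 63 / (d ^ 3 * e ^ 8 * h ^ 70) * (t ^ 63 / (t ^ 52 * t ^ 3 * t ^ 8))"
        by (simp only: power_mult_distrib inverse_mult_distrib divide_inverse mult_ac power_mult[symmetric]) simp
      also have "t ^ 63 / (t ^ 52 * t ^ 3 * t ^ 8) = 1"
        using elim(5) by (simp add: power_add[symmetric])
      finally show ?case
        by (simp add: Q_def a_def b_def c_def d_def e_def h_def)
    qed
  qed auto
  from R(3) nz' have "\<forall>\<^sub>F t in at 0. let u = e7u t; v = e7v t in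
            R t ^ 14 * u ^ 26 * (v - u) ^ 3 * (v + u) ^ 8 * G3 u v ^ 70
              = (1 - 8 * u) ^ 14 * F3t u v * G4h u v ^ 63 \<and>
            hyp3F2 (9/14) (11/14) (19/14) (11/7) (12/7) (Phi7 u v) = R t"
  proof eventually_elim
    case (elim t)
    define u v where "u = e7u t" and "v = e7v t"
    have "u ^ 26 * (v - u) ^ 3 * (v + u) ^ 8 * G3 u v ^ 70 \<noteq> 0"
      using elim(2) by (simp add: factors7_3_def ev7_factors u_def v_def del: ev7.simps)
    moreover have "R t ^ 14 = ((1 - 8 * u) ^ 14 * F3t u v * G4h u v ^ 63) / (u ^ 26 * (v - u) ^ 3 * (v + u) ^ 8 * G3 u v ^ 70)"
      using elim(1) by (simp add: prod7_factors7_3 Let_def u_def v_def)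
    ultimately have "R t ^ 14 * (u ^ 26 * (v - u) ^ 3 * (v + u) ^ 8 * G3 u v ^ 70) = (1 - 8 * u) ^ 14 * F3t u v * G4h u v ^ 63"
      by (metis nonzero_divide_eq_eq)
    then show ?case
      using elim(1) by (simp add: Let_def u_def v_def mult.assoc)
  qed
  then show ?thesis
    by (rule analytic_at_0_ballI[OF R(1,2)])
qed

text \<open>All exponents have denominator dividing 14, so the fractional powers are expressed
  through \<open>R t ^ 14\<close>; holomorphy and \<open>R 0 = 1\<close> fix the branch. A full disc
  in t covers both signs of the square root of u.\<close>

theorem mainTheorem15:
  shows
  "(\<exists>r>0. \<exists>R. R holomorphic_on ball 0 r \<and> R 0 = 1 \<and>
      (\<forall>t\<in>ball 0 r. t \<noteq> 0 \<longrightarrow>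
         (let u = e7u t; v = e7v t in
            R t ^ 14 * F3 u v * G4 u v ^ 7 = (1 - 4 * u)^2 * (1 - 8 * u)^8 * F4 u v ^ 4 \<and>
            hyp3F2 (-1/14) (1/14) (9/14) (2/7) (6/7) (Phi7 u v) = R t)))
 \<and> (\<exists>r>0. \<exists>R. R holomorphic_on ball 0 r \<and> R 0 = 1 \<and>
      (\<forall>t\<in>ball 0 r. t \<noteq> 0 \<longrightarrow>
         (let u = e7u t; v = e7v t in
            R t ^ 14 * (1 - 4 * u)^2 * F3t u v ^ 3 * G3 u v ^ 14
              = (1 - 8 * u) * F4t u v ^ 12 * G4 u v ^ 7 \<and>
            hyp3F2 (1/14) (3/14) (11/14) (3/7) (8/7) (Phi7 u v) = R t)))
 \<and> (\<exists>r>0. \<exists>R. R holomorphic_on ball 0 r \<and> R 0 = 1 \<and>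
      (\<forall>t\<in>ball 0 r. t \<noteq> 0 \<longrightarrow>
         (let u = e7u t; v = e7v t in
            R t ^ 14 * u ^ 26 * (v - u) ^ 3 * (v + u) ^ 8 * G3 u v ^ 70
              = (1 - 8 * u) ^ 14 * F3t u v * G4h u v ^ 63 \<and>
            hyp3F2 (9/14) (11/14) (19/14) (11/7) (12/7) (Phi7 u v) = R t)))"
  by (intro conjI hyp3F2_E7_evaluation_1 hyp3F2_E7_evaluation_2 hyp3F2_E7_evaluation_3)

end
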